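(* Let $k \ge 2$ be an integer. There exist $k$ distinct positive integers $c_1,\dots,c_k$, an infinite set $\mathcal{N}$ of positive integers, and for each $N \in \mathcal{N}$ a set $A_N \subset \mathbb{Z}_N = \mathbb{Z}/N\mathbb{Z}$ such that \[ |A_N| \geq \frac{N^{1/2}}{k}\,(1 - o(1)) \qquad (N \to \infty,\ N \in \mathcal{N}), \] and such that for each $N\in\mathcal N$ and each pair $1 \leq i \leq j \leq k$, the equation $c_i(x_1 - x_2) = c_j(x_3 - x_4)$ in $\mathbb{Z}_N$ has only trivial solutions with $x_1,x_2,x_3,x_4 \in A_N$.
   Context: A solution $(x_1,x_2,x_3,x_4)$ of $c_i(x_1 - x_2) = c_j(x_3 - x_4)$ is called trivial if either $x_1 = x_2$ and $x_3 = x_4$, or $i = j$ and $x_1 = x_3$, $x_2 = x_4$. *)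

theory Defs
  imports "HOL-Number_Theory.Number_Theory" "HOL-Library.Landau_Symbols" Complex_Main
begin

text \<open>
  The group \<open>\<int>/N\<int>\<close> is represented by its canonical residues \<open>{0..<N}\<close> in the integers,
  so that equality of residue classes is equality of representatives and equations
  are congruences modulo \<open>N\<close>.
\<close>

definition is_solution ::
  "nat \<Rightarrow> (nat \<Rightarrow> nat) \<Rightarrow> nat \<Rightarrow> nat \<Rightarrow> int \<Rightarrow> int \<Rightarrow> int \<Rightarrow> int \<Rightarrow> bool" where
  "is_solution N c i j x1 x2 x3 x4 \<longleftrightarrow>
     [int (c i) * (x1 - x2) = int (c j) * (x3 - x4)] (mod int N)"

definition trivial_solution ::
  "nat \<Rightarrow> nat \<Rightarrow> int \<Rightarrow> int \<Rightarrow> int \<Rightarrow> int \<Rightarrow> bool" where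
  "trivial_solution i j x1 x2 x3 x4 \<longleftrightarrow>
     (x1 = x2 \<and> x3 = x4) \<or> (i = j \<and> x1 = x3 \<and> x2 = x4)"

end

theory Submission
  imports Defs "HOL-Algebra.Algebraic_Closure_Type" "HOL-Algebra.Multiplicative_Group"
    "HOL-Library.Z2" "HOL-Real_Asymp.Real_Asymp"
begin

text \<open>
  If a Sidon set \<open>B\<close> in \<open>\<int>/N\<int>\<close> contains pairwise disjoint dilates \<open>c\<^sub>1A, \<dots>, c\<^sub>kA\<close> with all \<open>c\<^sub>i\<close>
  coprime to \<open>N\<close>, then the Sidon property of \<open>B\<close> forces every solution in \<open>A\<close> of
  \<open>c\<^sub>i(x\<^sub>1 - x\<^sub>2) = c\<^sub>j(x\<^sub>3 - x\<^sub>4)\<close> to be trivial. We use \<open>c\<^sub>i = 2\<^sup>i\<^sup>-\<^sup>1\<close> and a Bose-type set that is invariant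
  under doubling: for \<open>q = 2\<^sup>m\<close> with \<open>m\<close> odd, \<open>N = q\<^sup>2 - 1\<close>, a generator \<open>g\<close> of the multiplicative
  group of the field with \<open>q\<^sup>2\<close> elements, and \<open>\<omega>\<^sup>2 + \<omega> + 1 = 0\<close>, take the \<open>q\<close> discrete logarithms to base
  \<open>g\<close> of the elements \<open>\<omega> + a\<close> with \<open>a\<close> in the subfield of order \<open>q\<close>. Doubling a logarithm squares the
  element, and \<open>(\<omega> + a)\<^sup>2 = \<omega> + (1 + a\<^sup>2)\<close>. All but few orbits of doubling on \<open>B\<close> are long, and taking every
  \<open>k\<close>-th point of each long orbit gives \<open>A\<close> of size about \<open>q / k\<close>.
\<close>

section \<open>Finite fields inside an algebraically closed field\<close>

text \<open>\<open>P\<close> splits into linear factors, and a factor occurring twice would give a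
  common root of \<open>P\<close> and \<open>pderiv P\<close>. So the multiset of roots has no
  repetitions.\<close>

lemma card_roots_separable:
  fixes P :: "'a :: alg_closed_field poly"
  assumes "P \<noteq> 0" and sep: "\<And>a. poly P a = 0 \<Longrightarrow> poly (pderiv P) a \<noteq> 0"
  shows "card {x. poly P x = 0} = degree P"
proof -
  obtain A where A: "size A = degree P" "P = smult (lead_coeff P) (\<Prod>x\<in>#A. [:-x, 1:])"
    using alg_closed_imp_factorization[OF \<open>P \<noteq> 0\<close>] by blast
  have root_iff: "poly P x = 0 \<longleftrightarrow> x \<in># A" for x
    using \<open>P \<noteq> 0\<close> by (subst A(2)) (auto simp: poly_prod_mset)
  have count_one: "count A x = 1" if "x \<in># A" for x
  proof (rule ccontr)
    assume "count A x \<noteq> 1"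
    with that have "count A x \<ge> 2"
      by (metis Suc_1 Suc_leI count_greater_zero_iff le_neq_implies_less One_nat_def)
    then obtain B where B: "A = add_mset x (add_mset x B)"
      by (metis count_le_replicate_mset_subset_eq numeral_2_eq_2 replicate_mset_Suc replicate_mset_0
          subset_mset.le_iff_add union_mset_add_mset_left add_0)
    define R where "R = smult (lead_coeff P) (\<Prod>x\<in>#B. [:-x, 1:])"
    have "P = [:-x, 1:] * ([:-x, 1:] * R)"
      by (subst A(2)) (simp add: B R_def mult_ac)
    hence "poly P x = 0" "poly (pderiv P) x = 0"
      by (simp_all add: pderiv_mult del: mult_pCons_left)
    thus False using sep by blast
  qed
  have "card (set_mset A) = size A"
    unfolding size_multiset_overloaded_eq by (simp add: count_one)
  moreover have "{x. poly P x = 0} = set_mset A"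
    using root_iff by blast
  ultimately show ?thesis using A(1) by simp
qed

text \<open>The fixed points are the roots of X^q - X with q = \<open>CHAR('a) ^ n\<close>. Its
  derivative is -1, since q vanishes in the field, so it has q distinct roots. This supplies the
  subfield of order q.\<close>

lemma card_Frobenius_fixed:
  assumes "Factorial_Ring.prime CHAR('a :: alg_closed_field)" "n > 0"
  shows "card {x :: 'a. x ^ (CHAR('a) ^ n) = x} = CHAR('a) ^ n"
proof -
  let ?q = "CHAR('a) ^ n"
  define P :: "'a poly" where "P = monom 1 ?q - monom 1 1"
  have q: "?q > 1"
    using assms prime_gt_1_nat one_less_power by blast
  have deg: "degree P = ?q"
    unfolding P_def diff_conv_add_uminus using q
    by (subst degree_add_eq_left) (auto simp: degree_monom_eq)
  have "(of_nat ?q :: 'a) = 0"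
    using assms by (simp add: power_0_left)
  hence "pderiv P = -1"
    by (simp add: P_def pderiv_diff pderiv_monom one_pCons power_0_left)
  moreover have "P \<noteq> 0"
    using deg q by (metis degree_0 not_one_less_zero)
  ultimately have "card {x. poly P x = 0} = ?q"
    using card_roots_separable[of P] deg by simp
  thus ?thesis by (simp add: P_def poly_monom)
qed

text \<open>The multiplicative group of a finite field is cyclic; the set \<open>F\<close> is
  packaged as a ring record so that this fact applies to it.\<close>

lemma finite_subfield_has_generator:
  fixes F :: "'a :: Fields.field set"
  assumes "finite F" "0 \<in> F" "1 \<in> F"
    and add: "\<And>x y. x \<in> F \<Longrightarrow> y \<in> F \<Longrightarrow> x + y \<in> F"
    and uminus: "\<And>x. x \<in> F \<Longrightarrow> - x \<in> F"
    and mult: "\<And>x y. x \<in> F \<Longrightarrow> y \<in> F \<Longrightarrow> x * y \<in> F"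
    and inverse: "\<And>x. x \<in> F \<Longrightarrow> inverse x \<in> F"
  shows "\<exists>g\<in>F - {0}. F - {0} = range (\<lambda>i::nat. g ^ i)"
proof -
  define R :: "'a ring" where
    "R = \<lparr>carrier = F, monoid.mult = (*), one = 1, ring.zero = 0, add = (+)\<rparr>"
  have "\<exists>y\<in>F. y + x = 0 \<and> x + y = 0" if "x \<in> F" for x
    using uminus[OF that] by (intro bexI[of _ "-x"]) auto
  moreover have "\<exists>y\<in>F. y * x = 1 \<and> x * y = 1" if "x \<in> F" "x \<noteq> 0" for x
    using inverse[OF that(1)] that(2) by (intro bexI[of _ "inverse x"]) auto
  ultimately interpret R: Ring.field R
    using assms unfolding R_def
    by unfold_locales (auto simp: algebra_simps Units_def)
  have pow: "g [^]\<^bsub>R\<^esub> i = g ^ i" for g and i :: nat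
    by (induction i) (auto simp: R_def nat_pow_def)
  obtain g where "g \<in> carrier (mult_of R)"
    "carrier (mult_of R) = {g [^]\<^bsub>R\<^esub> i | i::nat. i \<in> UNIV}"
    using R.finite_field_mult_group_has_gen \<open>finite F\<close> by (auto simp: R_def)
  thus ?thesis
    unfolding pow by (intro bexI[of _ g]) (auto simp: R_def)
qed

section \<open>A Sidon set invariant under doubling\<close>

lemma CHAR_bit: "CHAR(bit) = 2"
proof (rule CHAR_eqI)
  show "2 dvd n" if "of_nat n = (0 :: bit)" for n
    using that by (metis even_of_nat even_zero)
qed simp

text \<open>Equal sums of logarithms give equal products (\<omega> + a)(\<omega> + b). As \<omega>
  lies outside the subfield of order \<open>2 ^ m\<close>, comparing coefficients of \<omega>
  recovers a + b and ab, and these determine the unordered pair.\<close>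

lemma doubling_invariant_Sidon_set:
  assumes "odd m" and N: "N = 2 ^ (2 * m) - (1::nat)"
  shows "\<exists>B\<subseteq>{..<N}. card B = 2 ^ m \<and> (\<forall>x\<in>B. 2 * x mod N \<in> B) \<and>
           (\<forall>x\<in>B. \<forall>y\<in>B. \<forall>z\<in>B. \<forall>w\<in>B.
              [x + y = z + w] (mod N) \<longrightarrow> x = z \<and> y = w \<or> x = w \<and> y = z)"
proof -
  have "m > 0" using \<open>odd m\<close> by (rule odd_pos)
  have two: "(2 :: bit alg_closure) = 0"
    using of_nat_CHAR[where 'a = "bit alg_closure"] by (simp add: CHAR_bit)
  have double: "x + x = 0" for x :: "bit alg_closure"
    using two by (metis mult_2 mult_zero_left)
  have minus: "- x = x" for x :: "bit alg_closure"
    using double[of x] by (metis add_eq_0_iff)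
  have frob: "(x + y) ^ (2 ^ n) = x ^ (2 ^ n) + y ^ (2 ^ n)" for x y :: "bit alg_closure" and n
    by (rule freshmans_dream') (auto simp: CHAR_bit)
  define F where "F n = {x :: bit alg_closure. x ^ (2 ^ n) = x}" for n :: nat
  have card_F: "card (F n) = 2 ^ n" if "n > 0" for n
    using card_Frobenius_fixed[where 'a = "bit alg_closure"] that by (simp add: CHAR_bit F_def)
  have F_closed: "0 \<in> F n" "1 \<in> F n" "x \<in> F n \<Longrightarrow> y \<in> F n \<Longrightarrow> x + y \<in> F n"
    "x \<in> F n \<Longrightarrow> - x \<in> F n" "x \<in> F n \<Longrightarrow> y \<in> F n \<Longrightarrow> x * y \<in> F n"
    "x \<in> F n \<Longrightarrow> inverse x \<in> F n" for x y n
    by (auto simp: F_def frob minus power_mult_distrib power_inverse)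
  have F_diff: "x - y \<in> F n" if "x \<in> F n" "y \<in> F n" for x y n
    using F_closed(3)[OF that(1) F_closed(4)[OF that(2)]] by simp
  have "finite (F (2 * m))"
    using card_F[of "2 * m"] \<open>m > 0\<close> by (intro card_ge_0_finite) simp
  hence "\<exists>g\<in>F (2 * m) - {0}. F (2 * m) - {0} = range (\<lambda>i. g ^ i)"
    by (rule finite_subfield_has_generator) (auto intro: F_closed)
  then obtain g where g: "g \<in> F (2 * m) - {0}" "F (2 * m) - {0} = range (\<lambda>i. g ^ i)"
    by blast
  have "(2::nat) ^ (2 * m) > 1"
    using \<open>m > 0\<close> by (intro one_less_power) auto
  hence "N > 0" and Suc_N: "2 ^ (2 * m) = Suc N" using N by auto
  have "g ^ Suc N = g" using g(1) unfolding F_def Suc_N by blast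
  hence "g ^ N = 1" using g(1) by simp
  have pow_mod: "g ^ (i mod N) = g ^ i" for i
  proof -
    have "g ^ i = g ^ (N * (i div N) + i mod N)" by simp
    also have "\<dots> = g ^ (i mod N)" unfolding power_add power_mult \<open>g ^ N = 1\<close> by simp
    finally show ?thesis ..
  qed
  have units: "F (2 * m) - {0} = (\<lambda>i. g ^ i) ` {..<N}"
  proof -
    have "g ^ i \<in> (\<lambda>i. g ^ i) ` {..<N}" for i
      using pow_mod[of i] \<open>N > 0\<close> by (intro image_eqI[of _ _ "i mod N"]) auto
    thus ?thesis using g(2) by auto
  qed
  have "card (F (2 * m) - {0}) = N"
    using card_F[of "2 * m"] \<open>m > 0\<close> F_closed by (simp add: N)
  hence inj: "inj_on (\<lambda>i. g ^ i) {..<N}"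
    unfolding units by (intro eq_card_imp_inj_on) auto
  have powI: "g ^ a = g ^ b" if "[a = b] (mod N)" for a b
    using that pow_mod unfolding Cong.cong_def by metis

  obtain \<omega> where "poly [:1, 1, 1 :: bit alg_closure:] \<omega> = 0"
    using alg_closed_imp_poly_has_root[of "[:1, 1, 1 :: bit alg_closure:]"] by auto
  hence "\<omega>\<^sup>2 + (\<omega> + 1) = 0"
    by (simp add: power2_eq_square algebra_simps)
  hence \<omega>_sq: "\<omega>\<^sup>2 = \<omega> + 1"
    by (metis minus add_eq_0_iff2)
  \<comment> \<open>Squaring swaps the two roots \<omega> and \<omega> + 1. Hence the oddness of
    \<open>m\<close> puts \<omega> in \<open>F (2 * m)\<close> but not in
    \<open>F m\<close>.\<close>
  have \<omega>_pow: "\<omega> ^ (2 ^ n) = (if even n then \<omega> else \<omega> + 1)" for n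
  proof (induction n)
    case (Suc n)
    have "\<omega> ^ (2 ^ Suc n) = (\<omega> ^ (2 ^ n))\<^sup>2" by (simp add: mult.commute flip: power_mult)
    also have "(\<omega> + 1)\<^sup>2 = \<omega>"
      using frob[of \<omega> 1 1] double[of 1] \<omega>_sq by (simp add: add.assoc)
    ultimately show ?case using Suc \<omega>_sq by simp
  qed simp
  have \<omega>_notin: "\<omega> \<notin> F m" and \<omega>_in: "\<omega> \<in> F (2 * m)"
    using \<open>odd m\<close> \<omega>_pow by (auto simp: F_def)
  have cancel: "\<omega> + (\<omega> + a) = a" for a
    using double[of \<omega>] by (simp flip: add.assoc)
  have F_mono: "F m \<subseteq> F (2 * m)"
    by (auto simp: F_def mult_2 power_add power_mult)

  \<comment> \<open>In characteristic 2, \<open>\<omega> + g ^ i = a\<close> says the same as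
    \<open>g ^ i = \<omega> + a\<close>, so \<open>B\<close> consists of the logarithms of the
    elements \<omega> + a, one for each a in \<open>F m\<close>.\<close>
  define B where "B = {i\<in>{..<N}. \<omega> + g ^ i \<in> F m}"
  have "bij_betw (\<lambda>i. \<omega> + g ^ i) B (F m)"
    unfolding bij_betw_def
  proof
    show "inj_on (\<lambda>i. \<omega> + g ^ i) B"
      using inj by (auto simp: B_def inj_on_def)
    show "(\<lambda>i. \<omega> + g ^ i) ` B = F m"
    proof
      show "F m \<subseteq> (\<lambda>i. \<omega> + g ^ i) ` B"
      proof
        fix a assume a: "a \<in> F m"
        have "\<omega> + a \<noteq> 0"
          using a \<omega>_notin minus by (metis add_eq_0_iff)
        moreover have "\<omega> + a \<in> F (2 * m)"
          using F_closed(3) \<omega>_in F_mono a by blast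
        ultimately obtain i where i: "i < N" "\<omega> + a = g ^ i"
          using units by blast
        hence "\<omega> + g ^ i = a" using cancel by metis
        thus "a \<in> (\<lambda>i. \<omega> + g ^ i) ` B"
          using a i by (intro image_eqI[of _ _ i]) (auto simp: B_def)
      qed
    qed (auto simp: B_def)
  qed
  hence "card B = 2 ^ m"
    using card_F \<open>m > 0\<close> by (simp add: bij_betw_same_card)
  moreover have "2 * i mod N \<in> B" if "i \<in> B" for i
  proof -
    define a where "a = \<omega> + g ^ i"
    have a: "a \<in> F m" and gi: "g ^ i = \<omega> + a"
      using that cancel by (auto simp: B_def a_def)
    have "g ^ (2 * i mod N) = (\<omega> + a)\<^sup>2"
      by (simp add: pow_mod mult.commute[of 2] power_mult gi)
    also have "\<dots> = \<omega> + (1 + a * a)"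
      using frob[of \<omega> a 1] \<omega>_sq by (simp add: power2_eq_square add.assoc)
    finally have "\<omega> + g ^ (2 * i mod N) = 1 + a * a"
      using cancel by simp
    thus ?thesis
      using a F_closed \<open>N > 0\<close> by (simp add: B_def)
  qed
  moreover have "x = z \<and> y = w \<or> x = w \<and> y = z"
    if B: "x \<in> B" "y \<in> B" "z \<in> B" "w \<in> B" and cong: "[x + y = z + w] (mod N)" for x y z w
  proof -
    define h where "h i = \<omega> + g ^ i" for i
    have h: "h i \<in> F m" if "i \<in> B" for i using that by (simp add: B_def h_def)
    have g_h: "g ^ i = \<omega> + h i" for i using cancel by (simp add: h_def)
    have h_inj: "i = j" if "h i = h j" "i \<in> B" "j \<in> B" for i j
      using that inj by (auto simp: h_def B_def inj_on_def)
    have "(\<omega> + h x) * (\<omega> + h y) = (\<omega> + h z) * (\<omega> + h w)"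
      using powI[OF cong] by (simp add: power_add g_h)
    hence eq: "\<omega> * ((h x + h y) - (h z + h w)) = h z * h w - h x * h y"
      by (simp add: algebra_simps)
    have mem: "(h x + h y) - (h z + h w) \<in> F m" "h z * h w - h x * h y \<in> F m"
      by (intro F_diff F_closed h B)+
    \<comment> \<open>Otherwise \<omega> would be a quotient of two elements of
      \<open>F m\<close>.\<close>
    have sum_eq: "(h x + h y) - (h z + h w) = 0"
    proof (rule ccontr)
      assume nz: "\<not> ?thesis"
      have "\<omega> = (h z * h w - h x * h y) * inverse ((h x + h y) - (h z + h w))"
        using eq nz by (simp add: field_simps)
      also have "\<dots> \<in> F m" by (intro F_closed mem)
      finally show False using \<omega>_notin by contradiction
    qed
    hence prod_eq: "h x * h y = h z * h w" using eq by simp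
    \<comment> \<open>By equality of sums and products, \<open>h x\<close> is a root of the
      quadratic with roots \<open>h z\<close> and \<open>h w\<close>.\<close>
    have "(h x - h z) * (h x - h w) = h x * ((h x + h y) - (h z + h w)) - (h x * h y - h z * h w)"
      by (simp add: algebra_simps)
    also have "\<dots> = 0" unfolding sum_eq prod_eq by simp
    finally have "(h x - h z) * (h x - h w) = 0" .
    hence "h x = h z \<or> h x = h w" by simp
    hence "h x = h z \<and> h y = h w \<or> h x = h w \<and> h y = h z"
      using sum_eq by (auto simp: algebra_simps)
    thus ?thesis
      using h_inj B by blast
  qed
  moreover have "B \<subseteq> {..<N}" by (auto simp: B_def)
  ultimately show ?thesis by blast
qed

section \<open>Separated points on the cycles of a permutation\<close>

lemma funpow_closed: "f ` S \<subseteq> S \<Longrightarrow> x \<in> S \<Longrightarrow> (f ^^ n) x \<in> S"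
  by (induction n) auto

lemma funpow_inj_onD:
  assumes "inj_on f S" "f ` S \<subseteq> S" "x \<in> S" "y \<in> S" "(f ^^ n) x = (f ^^ n) y"
  shows "x = y"
  using assms(5)
proof (induction n)
  case (Suc n)
  thus ?case using assms(1-4) by (auto dest: inj_onD simp: funpow_closed)
qed simp

text \<open>On a cycle of length \<open>l\<close>, every \<open>k\<close>-th point is taken, omitting the last \<open>l mod k\<close> points.\<close>
lemma separated_subset_of_permutation:
  fixes f :: "'a \<Rightarrow> 'a"
  assumes "finite S" "inj_on f S" "f ` S \<subseteq> S" "k > 0"
    and "\<And>x j. x \<in> S \<Longrightarrow> 0 < j \<Longrightarrow> j < L \<Longrightarrow> (f ^^ j) x \<noteq> x"
  shows "\<exists>A\<subseteq>S. (\<forall>x\<in>A. \<forall>y\<in>A. \<forall>d. 0 < d \<and> d < k \<longrightarrow> (f ^^ d) x \<noteq> y) \<and>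
           card S * (L - k) \<le> L * k * card A"
  using assms(1-3,5)
\<comment> \<open>One cycle is removed at a time. For k \<le> L and L > 0 the bound reads |A| \<ge>
  |S| (1/k - 1/L); for k > L truncated subtraction makes it trivial.\<close>
proof (induction S rule: finite_psubset_induct)
  case (psubset S)
  note inj = psubset.prems(1) and closed = psubset.prems(2) and free = psubset.prems(3)
  show ?case
  proof (cases "S = {}")
    case True
    thus ?thesis by auto
  next
    case False
    then obtain x where x: "x \<in> S" by blast
    \<comment> \<open>Two iterates of \<open>x\<close> coincide because \<open>S\<close> is finite,
      and injectivity cancels the common initial steps, so \<open>x\<close> is periodic.\<close>
    have "\<not> inj (\<lambda>n. (f ^^ n) x)"
      using funpow_closed[OF closed x] \<open>finite S\<close>
      by (metis finite_subset image_subsetI infinite_UNIV_nat finite_imageD)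
    then obtain a b where ab: "a < b" "(f ^^ a) x = (f ^^ b) x"
      by (metis injI linorder_neqE_nat)
    have "(f ^^ a) ((f ^^ (b - a)) x) = (f ^^ a) x"
      using ab by (simp flip: funpow_add o_apply[of "f ^^ a"])
    hence "(f ^^ (b - a)) x = x"
      using funpow_inj_onD[OF inj closed] funpow_closed[OF closed x] x by blast
    hence ex: "\<exists>l. l > 0 \<and> (f ^^ l) x = x"
      using ab by (intro exI[of _ "b - a"]) auto
    define l where "l = (LEAST l. l > 0 \<and> (f ^^ l) x = x)"
    have l: "l > 0" "(f ^^ l) x = x"
      using LeastI_ex[OF ex] by (auto simp: l_def)
    have l_min: "(f ^^ j) x \<noteq> x" if "0 < j" "j < l" for j
      using not_less_Least[of j] that by (auto simp: l_def)
    have "L \<le> l" using free[OF x l(1)] l(2) by (meson not_le_imp_less)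
    have lt: "(f ^^ a) x \<noteq> (f ^^ b) x" if "a < b" "b < l" for a b
    proof
      assume "(f ^^ a) x = (f ^^ b) x"
      hence "(f ^^ a) ((f ^^ (b - a)) x) = (f ^^ a) x"
        using that by (simp flip: funpow_add o_apply[of "f ^^ a"])
      hence "(f ^^ (b - a)) x = x"
        using funpow_inj_onD[OF inj closed] funpow_closed[OF closed x] x by blast
      thus False using l_min[of "b - a"] that by simp
    qed
    have inj_orbit: "a = b" if "(f ^^ a) x = (f ^^ b) x" "a < l" "b < l" for a b
      using lt[of a b] lt[of b a] that by (cases a b rule: linorder_cases) auto
    define C where "C = (\<lambda>i. (f ^^ i) x) ` {..<l}"
    have C: "C \<subseteq> S" "x \<in> C"
      using funpow_closed[OF closed x] l(1) by (auto simp: C_def intro!: image_eqI[of _ _ 0])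
    have card_C: "card C = l"
      unfolding C_def by (subst card_image) (auto intro!: inj_onI inj_orbit)
    have f_C: "f y \<in> C" if "y \<in> C" for y
    proof -
      from that obtain i where i: "i < l" "y = (f ^^ i) x" by (auto simp: C_def)
      show ?thesis
      proof (cases "Suc i < l")
        case True
        thus ?thesis unfolding C_def i(2) by (intro image_eqI[of _ _ "Suc i"]) auto
      next
        case False
        hence "Suc i = l" using i by simp
        hence "f y = x" using l(2) i by auto
        thus ?thesis using C by simp
      qed
    qed
    \<comment> \<open>An injective self-map of the finite set \<open>C\<close> is onto, so no point
      outside \<open>C\<close> is sent into it. Hence \<open>S - C\<close> is again closed under
      \<open>f\<close>, as the induction requires.\<close>
    have "f ` C = C"
      using f_C \<open>finite S\<close> C inj
      by (intro endo_inj_surj) (auto intro: finite_subset inj_on_subset)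
    hence f_C_iff: "f y \<in> C \<Longrightarrow> y \<in> C" if "y \<in> S" for y
      using that inj C by (metis (no_types, lifting) image_iff inj_on_contraD subset_iff)
    have closed': "f ` (S - C) \<subseteq> S - C" using closed f_C_iff by blast
    have "\<exists>A\<subseteq>S - C. (\<forall>x\<in>A. \<forall>y\<in>A. \<forall>d. 0 < d \<and> d < k \<longrightarrow> (f ^^ d) x \<noteq> y) \<and>
            card (S - C) * (L - k) \<le> L * k * card A"
    proof (rule psubset.IH)
      show "S - C \<subset> S" using C x by blast
      show "inj_on f (S - C)" using inj by (rule inj_on_diff)
    qed (use closed' free in auto)
    then obtain A where A: "A \<subseteq> S - C"
      "\<And>x y d. x \<in> A \<Longrightarrow> y \<in> A \<Longrightarrow> 0 < d \<Longrightarrow> d < k \<Longrightarrow> (f ^^ d) x \<noteq> y"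
      "card (S - C) * (L - k) \<le> L * k * card A"
      by blast
    define D where "D = (\<lambda>t. (f ^^ (k * t)) x) ` {..<l div k}"
    \<comment> \<open>Fewer than \<open>k\<close> steps from a chosen point never wrap around the
      cycle, so positions can be compared as plain numbers below \<open>l\<close>.\<close>
    have D_lt: "k * t + d < l" if "t < l div k" "d < k" for t d
    proof -
      have "k * t + d < k * Suc t" using that by simp
      also have "\<dots> \<le> k * (l div k)" using that by (intro mult_le_mono) auto
      also have "\<dots> \<le> l" by simp
      finally show ?thesis .
    qed
    have D_C: "D \<subseteq> C"
      using D_lt[of _ 0] \<open>k > 0\<close> by (auto simp: D_def C_def)
    have card_D: "card D = l div k"
      unfolding D_def
    proof (subst card_image)
      show "inj_on (\<lambda>t. (f ^^ (k * t)) x) {..<l div k}"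
        using \<open>k > 0\<close> D_lt[of _ 0] by (intro inj_onI) (auto dest!: inj_orbit)
    qed simp
    have D_sep: "(f ^^ d) y \<noteq> z" if yz: "y \<in> D" "z \<in> D" and d: "0 < d" "d < k" for y z d
    proof
      assume eq: "(f ^^ d) y = z"
      obtain s t where st: "s < l div k" "t < l div k" "y = (f ^^ (k * s)) x" "z = (f ^^ (k * t)) x"
        using yz by (auto simp: D_def)
      have "(f ^^ (d + k * s)) x = (f ^^ (k * t)) x"
        using eq st by (simp add: funpow_add)
      hence "d + k * s = k * t"
        using inj_orbit D_lt[OF st(1) d(2)] D_lt[OF st(2), of 0] \<open>k > 0\<close> by (simp add: add.commute)
      hence "d mod k = 0" by (metis mod_mult_self1_is_0 mod_mult_self2 mult.commute)
      thus False using d by simp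
    qed
    \<comment> \<open>Iteration never passes between \<open>C\<close> and its complement, so points
      of \<open>A\<close> and of \<open>D\<close> cannot violate the separation together.\<close>
    have stay: "(f ^^ d) y \<in> S - C \<longleftrightarrow> y \<in> S - C" if "y \<in> S" for y d
      using that funpow_closed[OF closed' , of y d] funpow_closed[of f C y d] f_C C by blast
    have sep: "(f ^^ d) y \<noteq> z" if "y \<in> A \<union> D" "z \<in> A \<union> D" "0 < d" "d < k" for y z d
      using that A(1,2) D_sep D_C C stay[of y d] by blast
    have fin: "finite A" "finite D" "finite C"
      using A D_C C \<open>finite S\<close> by (meson finite_Diff finite_subset)+
    have card_AD: "card (A \<union> D) = card A + l div k"
      using A D_C fin card_D by (subst card_Un_disjoint) auto
    have card_S: "card S = card (S - C) + l"
      using C card_C \<open>finite S\<close> by (metis card_Diff_subset card_mono fin(3) le_add_diff_inverse2)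
    \<comment> \<open>Rounding loses at most \<open>k\<close> points of the cycle, and L \<le> l
      turns this into a relative loss of at most k/L.\<close>
    have "l * (L - k) \<le> L * k * (l div k)"
    proof (cases "k \<le> L")
      case True
      have "l < k * (l div k) + k"
        using \<open>k > 0\<close> by (metis add.commute mod_less_divisor mult_div_mod_eq nat_add_left_cancel_less)
      hence "L * l \<le> L * (k * (l div k)) + L * k"
        by (metis add_mult_distrib2 less_imp_le mult_le_mono2)
      also have "L * k \<le> l * k" using \<open>L \<le> l\<close> by simp
      finally show ?thesis
        by (simp add: diff_mult_distrib2 mult_ac)
    qed auto
    hence "card S * (L - k) \<le> L * k * card (A \<union> D)"
      using A(3) unfolding card_AD card_S by (simp add: algebra_simps)
    thus ?thesis
      using A(1) D_C C sep by (intro exI[of _ "A \<union> D"]) blast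
  qed
qed

section \<open>Counting short doubling orbits and extracting the set with disjoint dilates\<close>

text \<open>Such an \<open>x\<close> satisfies \<open>(2 ^ j - 1) * x = N * t\<close> for some
  \<open>t < 2 ^ j\<close>, and \<open>t\<close> determines \<open>x\<close>.\<close>

lemma card_doubling_period_le:
  fixes N j :: nat
  assumes "j > 0"
  shows "card {x\<in>{..<N}. 2 ^ j * x mod N = x} \<le> 2 ^ j"
proof -
  define r where "r = (2 ^ j - 1 :: nat)"
  have "(2::nat) ^ j > 1" using assms by (intro one_less_power) auto
  hence r: "r > 0" "2 ^ j = Suc r" by (auto simp: r_def)
  have "{x\<in>{..<N}. 2 ^ j * x mod N = x} \<subseteq> (\<lambda>t. N * t div r) ` {..<2 ^ j}"
  proof
    fix x assume "x \<in> {x\<in>{..<N}. 2 ^ j * x mod N = x}"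
    hence x: "x < N" "(x + r * x) mod N = x" by (auto simp: r)
    have "x + r * x = N * ((x + r * x) div N) + x"
      using x(2) by (metis mult_div_mod_eq)
    hence "r * x = N * ((x + r * x) div N)" by linarith
    then obtain t where t: "r * x = N * t" by blast
    have "N * t < N * Suc r"
      unfolding t[symmetric] using x(1) r(1) by (simp add: mult.commute[of r] add_strict_increasing)
    hence "t < 2 ^ j" unfolding r by (simp only: mult_less_cancel1)
    moreover have "x = N * t div r" unfolding t[symmetric] using r(1) by simp
    ultimately show "x \<in> (\<lambda>t. N * t div r) ` {..<2 ^ j}" by blast
  qed
  hence "card {x\<in>{..<N}. 2 ^ j * x mod N = x} \<le> card {..<2 ^ j :: nat}"
    by (rule surj_card_le[rotated]) simp
  thus ?thesis by simp
qed

lemma funpow_doubling_mod: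
  fixes x N :: nat
  assumes "x < N"
  shows "((\<lambda>x. 2 * x mod N) ^^ j) x = 2 ^ j * x mod N"
proof (induction j)
  case (Suc j)
  have "((\<lambda>x. 2 * x mod N) ^^ Suc j) x = 2 * (2 ^ j * x mod N) mod N"
    using Suc by simp
  also have "\<dots> = 2 * (2 ^ j * x) mod N" by (rule mod_mult_right_eq)
  finally show ?case by (simp only: power_Suc mult.assoc)
qed (use assms in simp)

text \<open>The equation is rearranged so that no (truncated) subtraction of natural numbers occurs.\<close>
definition dilation_Sidon :: "nat \<Rightarrow> nat \<Rightarrow> nat set \<Rightarrow> bool" where
  "dilation_Sidon k N A \<longleftrightarrow>
     (\<forall>i j. i \<le> j \<and> j < k \<longrightarrow> (\<forall>x1\<in>A. \<forall>x2\<in>A. \<forall>x3\<in>A. \<forall>x4\<in>A.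
        [2 ^ i * x1 + 2 ^ j * x4 = 2 ^ j * x3 + 2 ^ i * x2] (mod N) \<longrightarrow>
        x1 = x2 \<and> x3 = x4 \<or> i = j \<and> x1 = x3 \<and> x2 = x4))"

text \<open>Orbits of length below \<open>L\<close> contain at most \<open>2 ^ L\<close> points, few
  against \<open>2 ^ (2 * L + 1)\<close>. Discarding them and rounding on the long orbits each cost
  a relative loss of at most k/L.\<close>

lemma exists_dilation_Sidon_set:
  fixes k L N :: nat
  assumes "0 < k" "k \<le> L" and N: "N = 2 ^ (2 * (2 * L + 1)) - 1"
  shows "\<exists>A\<subseteq>{..<N}. 2 ^ (2 * L + 1) / real k * (1 - 2 * real k / real L) \<le> real (card A) \<and>
           dilation_Sidon k N A"
proof -
  define q :: nat where "q = 2 ^ (2 * L + 1)"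
  obtain B where B: "B \<subseteq> {..<N}" "card B = q" "\<And>x. x \<in> B \<Longrightarrow> 2 * x mod N \<in> B"
    and Sidon: "\<And>x y z w. \<lbrakk>x \<in> B; y \<in> B; z \<in> B; w \<in> B; [x + y = z + w] (mod N)\<rbrakk>
                  \<Longrightarrow> x = z \<and> y = w \<or> x = w \<and> y = z"
    using doubling_invariant_Sidon_set[of "2 * L + 1" N] N unfolding q_def by auto
  have "finite B" using B(1) finite_subset by blast
  define f where "f x = 2 * x mod N" for x
  have f_pow: "(f ^^ j) x = 2 ^ j * x mod N" if "x < N" for x j
    using funpow_doubling_mod[OF that, of j] by (simp add: f_def[abs_def])
  \<comment> \<open>Oddness of \<open>N\<close> makes 2 invertible, so doubling permutes
    \<open>B\<close>.\<close>
  have N_odd: "odd N" unfolding N by simp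
  have inj: "inj_on f B"
  proof (rule inj_onI)
    fix x y assume xy: "x \<in> B" "y \<in> B" "f x = f y"
    hence "[2 * x = 2 * y] (mod N)" unfolding f_def Cong.cong_def by simp
    hence "[x = y] (mod N)"
      using N_odd by (simp add: cong_mult_lcancel_nat coprime_commute)
    thus "x = y" using xy B(1) by (auto intro: cong_less_modulus_unique_nat)
  qed
  have closed: "f ` B \<subseteq> B" using B(3) by (auto simp: f_def)
  define S where "S = {x\<in>B. \<forall>j. 0 < j \<and> j < L \<longrightarrow> (f ^^ j) x \<noteq> x}"
  have S_B: "S \<subseteq> B" by (auto simp: S_def)
  have closed_S: "f ` S \<subseteq> S"
  proof
    fix y assume "y \<in> f ` S"
    then obtain x where x: "x \<in> S" "y = f x" by blast
    have "(f ^^ j) (f x) \<noteq> f x" if j: "0 < j" "j < L" for j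
    proof
      assume "(f ^^ j) (f x) = f x"
      hence "f ((f ^^ j) x) = f x" by (simp add: funpow_swap1)
      hence "(f ^^ j) x = x"
        using inj_onD[OF inj] funpow_closed[OF closed] x S_B by blast
      thus False using x j by (simp add: S_def)
    qed
    thus "y \<in> S" using x closed by (auto simp: S_def)
  qed
  have "\<exists>A\<subseteq>S. (\<forall>x\<in>A. \<forall>y\<in>A. \<forall>d. 0 < d \<and> d < k \<longrightarrow> (f ^^ d) x \<noteq> y) \<and>
          card S * (L - k) \<le> L * k * card A"
  proof (rule separated_subset_of_permutation)
    show "finite S" using \<open>finite B\<close> S_B by (rule rev_finite_subset)
    show "inj_on f S" using inj S_B by (rule inj_on_subset)
  qed (use closed_S \<open>0 < k\<close> in \<open>auto simp: S_def\<close>)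
  then obtain A where A: "A \<subseteq> S" "card S * (L - k) \<le> L * k * card A"
    and sep: "\<And>x y d. \<lbrakk>x \<in> A; y \<in> A; 0 < d; d < k\<rbrakk> \<Longrightarrow> (f ^^ d) x \<noteq> y"
    by blast
  have "B - S \<subseteq> (\<Union>j\<in>{1..<L}. {x\<in>{..<N}. 2 ^ j * x mod N = x})"
  proof
    fix x assume "x \<in> B - S"
    then obtain j where "x \<in> B" "0 < j" "j < L" "(f ^^ j) x = x" by (auto simp: S_def)
    thus "x \<in> (\<Union>j\<in>{1..<L}. {x\<in>{..<N}. 2 ^ j * x mod N = x})"
      using f_pow B(1) by force
  qed
  hence "card (B - S) \<le> card (\<Union>j\<in>{1..<L}. {x\<in>{..<N}. 2 ^ j * x mod N = x})"
    by (rule card_mono[rotated]) auto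
  also have "\<dots> \<le> (\<Sum>j\<in>{1..<L}. card {x\<in>{..<N}. 2 ^ j * x mod N = x})"
    by (rule card_UN_le) simp
  also have "\<dots> \<le> (\<Sum>j\<in>{1..<L}. 2 ^ j)"
    by (intro sum_mono card_doubling_period_le) auto
  also have "\<dots> \<le> (\<Sum>j<L. 2 ^ j)"
    by (intro sum_mono2) auto
  also have "\<dots> \<le> 2 ^ L"
    using mask_eq_sum_exp_nat[of L] by (simp add: lessThan_def)
  finally have "card (B - S) \<le> 2 ^ L" .
  moreover have "card (B - S) = q - card S"
    using S_B \<open>finite B\<close> B(2) by (simp add: card_Diff_subset finite_subset)
  ultimately have card_S: "q \<le> card S + 2 ^ L" by simp
  \<comment> \<open>In the count weighted by \<open>L - k\<close>, the discarded points cost at most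
    \<open>2 ^ L * L\<close>, which this bounds by \<open>q\<close> and hence by
    \<open>q * k\<close>.\<close>
  have "2 ^ L * L \<le> (2::nat) ^ L * 2 ^ L" by simp
  also have "\<dots> \<le> q" by (simp add: q_def mult_2 power_add)
  finally have "2 ^ L * L \<le> q" .
  have "q * (L - k) \<le> (card S + 2 ^ L) * (L - k)"
    using card_S by (rule mult_le_mono1)
  also have "\<dots> \<le> L * k * card A + 2 ^ L * L"
    unfolding add_mult_distrib using A(2) by (rule add_mono) simp
  also have "\<dots> \<le> L * k * card A + q * k"
    using mult_le_mono[OF \<open>2 ^ L * L \<le> q\<close>, of 1 k] \<open>0 < k\<close> by simp
  finally have "real (q * (L - k)) \<le> real (L * k * card A + q * k)"
    by (rule of_nat_mono)
  hence "real q * (real L - 2 * real k) \<le> real L * real k * real (card A)"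
    using \<open>k \<le> L\<close> by (simp add: of_nat_diff algebra_simps)
  hence card_A: "2 ^ (2 * L + 1) / real k * (1 - 2 * real k / real L) \<le> real (card A)"
    using \<open>0 < k\<close> \<open>k \<le> L\<close> by (simp add: q_def field_simps)
  have triv: "x1 = x2 \<and> x3 = x4 \<or> i = j \<and> x1 = x3 \<and> x2 = x4"
    if "i \<le> j" "j < k" and x: "x1 \<in> A" "x2 \<in> A" "x3 \<in> A" "x4 \<in> A"
      and cong: "[2 ^ i * x1 + 2 ^ j * x4 = 2 ^ j * x3 + 2 ^ i * x2] (mod N)"
    for i j x1 x2 x3 x4
  proof -
    have xB: "x1 \<in> B" "x2 \<in> B" "x3 \<in> B" "x4 \<in> B" using x A(1) S_B by auto
    have pow_B: "(f ^^ n) x \<in> B" if "x \<in> B" for n x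
      using funpow_closed[OF closed that] .
    have pow_inj: "x = y" if "(f ^^ n) x = (f ^^ n) y" "x \<in> B" "y \<in> B" for n x y
      using funpow_inj_onD[OF inj closed that(2,3,1)] .
    \<comment> \<open>Modulo \<open>N\<close>, the dilates by \<open>2 ^ i\<close> and
      \<open>2 ^ j\<close> are iterates of \<open>f\<close>, which stay in \<open>B\<close>; the
      equation becomes a Sidon relation.\<close>
    have "[(f ^^ i) x1 + (f ^^ j) x4 = (f ^^ j) x3 + (f ^^ i) x2] (mod N)"
      using cong xB B(1) by (simp add: subset_iff f_pow Cong.cong_def mod_add_eq)
    hence "(f ^^ i) x1 = (f ^^ j) x3 \<and> (f ^^ j) x4 = (f ^^ i) x2 \<or>
           (f ^^ i) x1 = (f ^^ i) x2 \<and> (f ^^ j) x4 = (f ^^ j) x3"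
      using xB pow_B by (intro Sidon) auto
    thus ?thesis
    proof (elim disjE conjE)
      assume eq: "(f ^^ i) x1 = (f ^^ j) x3" "(f ^^ j) x4 = (f ^^ i) x2"
      show ?thesis
      proof (cases "i = j")
        case True
        thus ?thesis using eq pow_inj xB by metis
      next
        case False
        \<comment> \<open>For i < j, cancelling \<open>i\<close> doublings would place
          \<open>x1\<close> exactly \<open>j - i < k\<close> steps after \<open>x3\<close>, which
          the separation of \<open>A\<close> forbids.\<close>
        have "(f ^^ j) x3 = (f ^^ i) ((f ^^ (j - i)) x3)"
          using \<open>i \<le> j\<close> by (simp flip: funpow_add o_apply[of "f ^^ i"])
        hence "x1 = (f ^^ (j - i)) x3" using eq(1) pow_inj pow_B xB by metis
        moreover have "0 < j - i" "j - i < k" using False \<open>i \<le> j\<close> \<open>j < k\<close> by auto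
        ultimately show ?thesis using sep x by blast
      qed
    next
      assume "(f ^^ i) x1 = (f ^^ i) x2" "(f ^^ j) x4 = (f ^^ j) x3"
      thus ?thesis using pow_inj[of i x1 x2] pow_inj[of j x4 x3] xB by simp
    qed
  qed
  have "dilation_Sidon k N A" using triv unfolding dilation_Sidon_def by blast
  moreover have "A \<subseteq> {..<N}" using A(1) S_B B(1) by blast
  ultimately show ?thesis using card_A by blast
qed

section \<open>Choice of the moduli and the error term, and passage to integer residues\<close>

theorem theorem1p4:
  fixes k :: nat
  assumes "k \<ge> 2"
  shows "\<exists>(c :: nat \<Rightarrow> nat) (Ns :: nat set) (A :: nat \<Rightarrow> int set) (\<epsilon> :: nat \<Rightarrow> real).
           inj_on c {1..k} \<and> (\<forall>i\<in>{1..k}. c i > 0) \<and>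
           infinite Ns \<and> (\<forall>N\<in>Ns. N > 0) \<and>
           (\<forall>N\<in>Ns. A N \<subseteq> {0..<int N}) \<and>
           \<epsilon> \<in> o[inf at_top (principal Ns)](\<lambda>_. 1) \<and>
           (\<forall>N\<in>Ns. real (card (A N)) \<ge> sqrt (real N) / real k * (1 - \<epsilon> N)) \<and>
           (\<forall>N\<in>Ns. \<forall>i j. 1 \<le> i \<and> i \<le> j \<and> j \<le> k \<longrightarrow>
              (\<forall>x1\<in>A N. \<forall>x2\<in>A N. \<forall>x3\<in>A N. \<forall>x4\<in>A N.
                 is_solution N c i j x1 x2 x3 x4 \<longrightarrow> trivial_solution i j x1 x2 x3 x4))"
proof -
  define c :: "nat \<Rightarrow> nat" where "c i = 2 ^ (i - 1)" for i
  define modulus :: "nat \<Rightarrow> nat" where "modulus L = 2 ^ (2 * (2 * L + 1)) - 1" for L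
  \<comment> \<open>Starting at L = 2k keeps 1 - 2k/L nonnegative, so \<open>sqrt (real N)\<close>
    may later be replaced by the larger \<open>2 ^ (2 * L + 1)\<close>.\<close>
  define Ns where "Ns = modulus ` {2 * k..}"
  \<comment> \<open>For \<open>N = modulus L\<close> this is \<open>2 * k / L\<close>.\<close>
  define \<epsilon> where "\<epsilon> N = 8 * real k / (log 2 (real N + 1) - 2)" for N :: nat
  have modulus: "real (modulus L) + 1 = 2 ^ (2 * (2 * L + 1))" for L
    by (simp add: modulus_def of_nat_diff)
  have "strict_mono modulus"
  proof (rule strict_monoI)
    fix L M :: nat assume "L < M"
    hence "real (modulus L) + 1 < real (modulus M) + 1"
      unfolding modulus by (intro power_strict_increasing) auto
    thus "modulus L < modulus M" by simp
  qed
  hence inj: "inj modulus" by (rule strict_mono_imp_inj_on)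
  have Ns_inf: "infinite Ns"
    unfolding Ns_def using inj by (metis finite_imageD inj_on_subset infinite_Ici top_greatest)
  have Ns_pos: "N > 0" if N: "N \<in> Ns" for N
  proof -
    have "(2::nat) ^ (2 * (2 * L + 1)) > 1" for L by (intro one_less_power) auto
    thus ?thesis using N by (auto simp: Ns_def modulus_def)
  qed
  \<comment> \<open>For N = \<open>modulus L\<close>, log 2 (N + 1) - 2 is 4L. Writing the error
    through this logarithm defines it for every \<open>N\<close>, so its limit can be taken along
    all of \<open>at_top\<close> and then restricted to \<open>Ns\<close>.\<close>
  have \<epsilon>_modulus: "\<epsilon> (modulus L) = 2 * real k / real L" for L
  proof -
    have "log 2 (real (modulus L) + 1) = 2 * (2 * real L + 1)"
      unfolding modulus by (subst log_nat_power) auto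
    thus ?thesis by (simp add: \<epsilon>_def)
  qed
  have "(\<epsilon> \<longlongrightarrow> 0) at_top" unfolding \<epsilon>_def by real_asymp
  hence "\<epsilon> \<in> o[at_top](\<lambda>_. 1)" by (intro smalloI_tendsto) auto
  hence \<epsilon>: "\<epsilon> \<in> o[inf at_top (principal Ns)](\<lambda>_. 1)"
    by (rule landau_o.small.filter_mono[rotated]) simp
  have "\<exists>A\<subseteq>{..<N}. sqrt (real N) / real k * (1 - \<epsilon> N) \<le> real (card A) \<and> dilation_Sidon k N A"
    if "N \<in> Ns" for N
  proof -
    obtain L where L: "2 * k \<le> L" "N = modulus L" using \<open>N \<in> Ns\<close> by (auto simp: Ns_def)
    have "sqrt (real N) \<le> sqrt ((2 ^ (2 * L + 1))\<^sup>2)"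
    proof (rule real_sqrt_le_mono)
      have "real N \<le> 2 ^ (2 * (2 * L + 1))"
        using modulus[of L] unfolding L(2) by linarith
      thus "real N \<le> (2 ^ (2 * L + 1))\<^sup>2" unfolding power_mult[symmetric] by (simp only: mult.commute)
    qed
    hence "sqrt (real N) \<le> 2 ^ (2 * L + 1)" by (simp only: real_sqrt_abs abs_of_nonneg zero_le_power zero_le_numeral)
    moreover have "0 \<le> 1 - 2 * real k / real L"
      using L(1) assms by (simp add: field_simps)
    ultimately have "sqrt (real N) / real k * (1 - 2 * real k / real L)
        \<le> 2 ^ (2 * L + 1) / real k * (1 - 2 * real k / real L)"
      by (intro mult_right_mono divide_right_mono) auto
    hence le: "sqrt (real N) / real k * (1 - \<epsilon> N)
        \<le> 2 ^ (2 * L + 1) / real k * (1 - 2 * real k / real L)" unfolding L(2) \<epsilon>_modulus .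
    have "0 < k" "k \<le> L" using L(1) assms by auto
    then obtain A where "A \<subseteq> {..<N}" "dilation_Sidon k N A"
      "2 ^ (2 * L + 1) / real k * (1 - 2 * real k / real L) \<le> real (card A)"
      using exists_dilation_Sidon_set[OF _ _ L(2)[unfolded modulus_def]] by blast
    thus ?thesis using order_trans[OF le] by blast
  qed
  then obtain A where A: "\<And>N. N \<in> Ns \<Longrightarrow> A N \<subseteq> {..<N}"
    "\<And>N. N \<in> Ns \<Longrightarrow> sqrt (real N) / real k * (1 - \<epsilon> N) \<le> real (card (A N))"
    "\<And>N. N \<in> Ns \<Longrightarrow> dilation_Sidon k N (A N)"
    by metis
  have trivial: "trivial_solution i j x1 x2 x3 x4"
    if "N \<in> Ns" and ij: "1 \<le> i" "i \<le> j" "j \<le> k"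
      and x: "x1 \<in> int ` A N" "x2 \<in> int ` A N" "x3 \<in> int ` A N" "x4 \<in> int ` A N"
      and sol: "is_solution N c i j x1 x2 x3 x4" for N i j x1 x2 x3 x4
  proof -
    obtain y1 y2 y3 y4 where y: "y1 \<in> A N" "y2 \<in> A N" "y3 \<in> A N" "y4 \<in> A N"
      "x1 = int y1" "x2 = int y2" "x3 = int y3" "x4 = int y4"
      using x by blast
    \<comment> \<open>Moving the negative terms across leaves sums only, so the integer congruence
      descends to natural numbers.\<close>
    have "[int (c i * y1 + c j * y4) = int (c j * y3 + c i * y2)] (mod int N)"
      using sol unfolding is_solution_def y cong_iff_dvd_diff by (simp add: algebra_simps)
    hence "[2 ^ (i - 1) * y1 + 2 ^ (j - 1) * y4 = 2 ^ (j - 1) * y3 + 2 ^ (i - 1) * y2] (mod N)"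
      unfolding cong_int_iff c_def .
    moreover have "i - 1 \<le> j - 1" "j - 1 < k" using ij by auto
    ultimately have "y1 = y2 \<and> y3 = y4 \<or> i - 1 = j - 1 \<and> y1 = y3 \<and> y2 = y4"
      using A(3)[OF \<open>N \<in> Ns\<close>] y(1-4) unfolding dilation_Sidon_def by blast
    thus ?thesis
      using ij unfolding trivial_solution_def y by auto
  qed
  have c: "inj_on c {1..k}" "\<forall>i\<in>{1..k}. c i > 0"
    by (auto simp: inj_on_def c_def)
  have A_sub: "\<forall>N\<in>Ns. int ` A N \<subseteq> {0..<int N}"
  proof
    fix N assume "N \<in> Ns"
    from A(1)[OF this] show "int ` A N \<subseteq> {0..<int N}" by auto
  qed
  have A_card: "\<forall>N\<in>Ns. sqrt (real N) / real k * (1 - \<epsilon> N) \<le> real (card (int ` A N))"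
    using A(2) by (simp add: card_image)
  show ?thesis
  proof (intro exI[of _ c] exI[of _ Ns] exI[of _ "\<lambda>N. int ` A N"] exI[of _ \<epsilon>] conjI)
    show "\<forall>N\<in>Ns. \<forall>i j. 1 \<le> i \<and> i \<le> j \<and> j \<le> k \<longrightarrow>
       (\<forall>x1\<in>int ` A N. \<forall>x2\<in>int ` A N. \<forall>x3\<in>int ` A N. \<forall>x4\<in>int ` A N.
          is_solution N c i j x1 x2 x3 x4 \<longrightarrow> trivial_solution i j x1 x2 x3 x4)"
      by (intro ballI allI impI, elim conjE) (rule trivial)
    show "\<forall>N\<in>Ns. N > 0" using Ns_pos by blast
  qed (rule c Ns_inf A_sub \<epsilon> A_card)+
qed

end
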